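(* Let $SA_1\ldots A_n$ be a simplex in $\mathbb R^n$ that is right at $S$, let $L'$ be a $k$-dimensional affine subspace of $\mathbb R^n$ with $1\le k\le n-1$, let $d=\operatorname{dist}(S,L')$, and, when $d>0$, let $\varphi$ be the angle between $\overrightarrow{SF}$ and $\mathbf z$. Then, for every real $\lambda$, $$\sum_{i=1}^{n}\frac{B_iH_i^2}{SA_i^2}=n\lambda^2-2k\lambda+k+\frac{d^2}{h^2}-2\lambda\frac{d}{h}\cos\varphi,$$ where for $d=0$ the last term is read as $0$.
   Context: $S$ is identified with the origin of Euclidean space $\mathbb R^n$ and $\mathbf u_i=\overrightarrow{SA_i}$. The simplex is right at $S$ if $SA_i\perp SA_j$ for all $i\ne j$. $F$ is the foot of the perpendicular from $S$ to the affine subspace $L'$. $\mathbf z=\sum_{i=1}^{n}\mathbf u_i/SA_i^2$. $h$ is the length of the altitude from $S$ to the hyperplane of the opposite facet $A_1\ldots A_n$. $H_i$ is the orthogonal projection of $A_i$ onto $L'$, and $B_i$ is the point with $\overrightarrow{SB_i}=\lambda\mathbf u_i$. For points $X,Y$, $XY$ denotes their Euclidean distance. *)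

theory Defs
  imports "HOL-Analysis.Analysis"
begin

text \<open>The vertices \<open>A\<^sub>1, \<dots>, A\<^sub>n\<close> are indexed by the finite index type \<open>'n\<close> of the ambient space
  \<open>real ^ 'n\<close>, so that there are exactly \<open>n = CARD('n)\<close> of them. Injectivity of \<open>A\<close> and \<open>S \<notin> range A\<close>
  are needed because \<^const>\<open>affine_dependent\<close> speaks about the set of vertices only, which does not
  see repetitions.\<close>

definition simplex_vertices :: "real ^ 'n \<Rightarrow> ('n \<Rightarrow> real ^ 'n) \<Rightarrow> bool" where
  "simplex_vertices S A \<longleftrightarrow>
     inj A \<and> S \<notin> range A \<and> \<not> affine_dependent (insert S (range A))"

definition right_at :: "real ^ 'n \<Rightarrow> ('n \<Rightarrow> real ^ 'n) \<Rightarrow> bool" where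
  "right_at S A \<longleftrightarrow> (\<forall>i j. i \<noteq> j \<longrightarrow> orthogonal (A i - S) (A j - S))"

definition is_foot :: "'a::euclidean_space set \<Rightarrow> 'a \<Rightarrow> 'a \<Rightarrow> bool" where
  "is_foot L x p \<longleftrightarrow> p \<in> L \<and> (\<forall>y\<in>L. orthogonal (x - p) (y - p))"

text \<open>Assuming \<^const>\<open>is_foot\<close> of a point is harmless: for nonempty affine sets
  the foot exists and is unique.\<close>

lemma is_foot_ex1:
  fixes L :: "'a::euclidean_space set"
  assumes "affine L" "L \<noteq> {}"
  shows "\<exists>!p. is_foot L x p"
proof (rule ex_ex1I)
  obtain a where a: "a \<in> L" using assms(2) by blast
  have sub: "subspace ((\<lambda>y. y - a) ` L)"
    using affine_diffs_subspace_subtract[OF assms(1) a] .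
  obtain y z where y: "y \<in> span ((\<lambda>y. y - a) ` L)"
    and z: "\<And>w. w \<in> span ((\<lambda>y. y - a) ` L) \<Longrightarrow> orthogonal z w" and xa: "x - a = y + z"
    using orthogonal_subspace_decomp_exists[of "(\<lambda>y. y - a) ` L" "x - a"] by metis
  have yL: "y \<in> (\<lambda>y. y - a) ` L"
    using y sub by (metis span_eq_iff)
  then have p: "y + a \<in> L" by auto
  have "orthogonal (x - (y + a)) (w - (y + a))" if w: "w \<in> L" for w
  proof -
    have "w - a \<in> (\<lambda>y. y - a) ` L" using w by blast
    then have "w - a - y \<in> span ((\<lambda>y. y - a) ` L)"
      using y by (simp add: span_base span_diff)
    then have "orthogonal z (w - a - y)" by (rule z)
    moreover have "x - (y + a) = z" and "w - a - y = w - (y + a)"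
      using xa by (simp_all add: algebra_simps)
    ultimately show ?thesis by metis
  qed
  then show "\<exists>p. is_foot L x p" unfolding is_foot_def using p by blast
next
  fix p q assume "is_foot L x p" "is_foot L x q"
  then have "(x - p) \<bullet> (q - p) = 0" "(x - q) \<bullet> (p - q) = 0"
    by (auto simp: is_foot_def orthogonal_def)
  then have "(q - p) \<bullet> (q - p) = 0" by (simp add: inner_diff inner_commute)
  then show "p = q" by simp
qed

text \<open>Meaningful for nonzero \<open>u\<close> and \<open>v\<close> only.\<close>

definition vec_angle :: "'a::real_inner \<Rightarrow> 'a \<Rightarrow> real" where
  "vec_angle u v = arccos (u \<bullet> v / (norm u * norm v))"

end

theory Submission
  imports Defs
begin

text \<open>
  Put \<open>u\<^sub>i = A\<^sub>i - S\<close>, \<open>f = F - S\<close>, and let \<open>V\<close> be the direction space of \<open>L'\<close>. The vectors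
  \<open>e\<^sub>i = u\<^sub>i / SA\<^sub>i\<close> form an orthonormal basis, \<open>f\<close> is orthogonal to \<open>V\<close>, and
  \<open>g\<^sub>i = H\<^sub>i - F\<close> is the projection of \<open>u\<^sub>i\<close> to \<open>V\<close>. Expanding the square of
  \<open>B\<^sub>i - H\<^sub>i = lam u\<^sub>i - g\<^sub>i - f\<close> with \<open>u\<^sub>i \<bullet> g\<^sub>i = g\<^sub>i \<bullet> g\<^sub>i\<close> and \<open>g\<^sub>i \<bullet> f = 0\<close>, dividing by \<open>SA\<^sub>i\<^sup>2\<close>
  and summing yields
  \<open>n lam\<^sup>2 + (1 - 2 lam) (\<Sum>\<^sub>i g\<^sub>i\<^sup>2 / SA\<^sub>i\<^sup>2) + d\<^sup>2 (\<Sum>\<^sub>i 1 / SA\<^sub>i\<^sup>2) - 2 lam (f \<bullet> z)\<close>.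

  The first sum is the trace of the orthogonal projection to \<open>V\<close>, computed in the basis \<open>e\<close>;
  hence it equals \<open>dim V = k\<close> (\<open>sum_norm_feet_orthonormal\<close>). The second sum is \<open>1 / h\<^sup>2\<close>, the
  classical altitude formula of a right simplex (\<open>altitude_right_simplex\<close>), and it is also
  \<open>z \<bullet> z\<close>, so that \<open>f \<bullet> z = d (1 / h) cos \<phi>\<close>.
\<close>

section \<open>Orthonormal families\<close>

lemma parseval_orthonormal:
  fixes e :: "'n \<Rightarrow> real ^ 'n"
  assumes "\<And>i. norm (e i) = 1" "\<And>i j. i \<noteq> j \<Longrightarrow> orthogonal (e i) (e j)"
  shows "(\<Sum>i\<in>UNIV. (e i \<bullet> x)\<^sup>2) = (norm x)\<^sup>2"
proof -
  define M where "M = (\<chi> i. e i)"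
  have "orthogonal_matrix M"
    using assms by (simp add: orthogonal_matrix_orthonormal_rows M_def row_def vec_lambda_eta)
  then have "norm (M *v x) = norm x"
    by (simp add: orthogonal_transformation_matrix orthogonal_transformation_norm)
  moreover have "M *v x = (\<chi> i. e i \<bullet> x)"
    by (simp add: M_def matrix_vector_mul_component vec_eq_iff)
  ultimately have "(norm x)\<^sup>2 = (\<chi> i. e i \<bullet> x) \<bullet> (\<chi> i. e i \<bullet> x)"
    by (metis power2_norm_eq_inner)
  then show ?thesis by (simp add: inner_vec_def power2_eq_square)
qed

text \<open>The trace of an orthogonal projection is the dimension of its range: summing
  \<open>(e i \<bullet> c)\<^sup>2\<close> first over an orthonormal basis of \<open>V\<close> gives the left side, and first over \<open>i\<close>
  gives \<open>1\<close> for every \<open>c\<close>.\<close>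

lemma sum_norm_feet_orthonormal:
  fixes e g :: "'n \<Rightarrow> real ^ 'n"
  assumes e: "\<And>i. norm (e i) = 1" "\<And>i j. i \<noteq> j \<Longrightarrow> orthogonal (e i) (e j)"
    and V: "subspace V" and g: "\<And>i. is_foot V (e i) (g i)"
  shows "(\<Sum>i\<in>UNIV. (norm (g i))\<^sup>2) = real (dim V)"
proof -
  obtain C where C: "C \<subseteq> V" "pairwise orthogonal C" "\<And>c. c \<in> C \<Longrightarrow> norm c = 1"
      "independent C" "card C = dim V" "span C = V"
    using orthonormal_basis_subspace[OF V] by metis
  have fin: "finite C"
    using C(4) by (rule independent_imp_finite)
  have ec: "e i \<bullet> c = g i \<bullet> c" if "c \<in> C" for i c
  proof -
    have "c + g i \<in> V"
      using that C(1) g[of i] V by (auto simp: is_foot_def intro: subspace_add)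
    then have "(e i - g i) \<bullet> (c + g i - g i) = 0"
      using g[of i] unfolding is_foot_def orthogonal_def by blast
    then show ?thesis by (simp add: inner_diff_left)
  qed
  have "(norm (g i))\<^sup>2 = (\<Sum>c\<in>C. (e i \<bullet> c)\<^sup>2)" for i
  proof -
    have "g i \<in> span C"
      using g[of i] C(6) by (simp add: is_foot_def)
    then have "g i = (\<Sum>c\<in>C. (c \<bullet> g i) *\<^sub>R c)"
      using orthonormal_basis_expand[OF C(2,3) _ fin, of "g i"] by (simp add: inner_commute)
    then have "g i \<bullet> g i = (\<Sum>c\<in>C. (c \<bullet> g i) *\<^sub>R c) \<bullet> g i" by simp
    also have "\<dots> = (\<Sum>c\<in>C. (e i \<bullet> c)\<^sup>2)"
      unfolding inner_sum_left
      by (rule sum.cong) (simp_all add: ec power2_eq_square inner_commute[of _ "g i"])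
    finally show ?thesis by (simp add: power2_norm_eq_inner)
  qed
  then have "(\<Sum>i\<in>UNIV. (norm (g i))\<^sup>2) = (\<Sum>i\<in>UNIV. \<Sum>c\<in>C. (e i \<bullet> c)\<^sup>2)" by simp
  also have "\<dots> = (\<Sum>c\<in>C. \<Sum>i\<in>UNIV. (e i \<bullet> c)\<^sup>2)" by (rule sum.swap)
  also have "\<dots> = (\<Sum>c\<in>C. 1)"
    using C(3) by (intro sum.cong) (simp_all add: parseval_orthonormal[OF e])
  finally show ?thesis using C(5) by simp
qed

section \<open>Feet of perpendiculars and angles\<close>

lemma infdist_foot:
  assumes "is_foot L x p"
  shows "infdist x L = dist x p"
proof (rule antisym)
  have p: "p \<in> L" using assms by (simp add: is_foot_def)
  then show "infdist x L \<le> dist x p" by (rule infdist_le)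
  have "dist x p \<le> dist x y" if "y \<in> L" for y
  proof -
    have "(x - p) \<bullet> (y - p) = 0"
      using assms that by (simp add: is_foot_def orthogonal_def)
    then have "orthogonal (x - p) (p - y)"
      by (simp add: orthogonal_def inner_diff_right)
    then have "(norm (x - y))\<^sup>2 = (norm (x - p))\<^sup>2 + (norm (p - y))\<^sup>2"
      using norm_add_Pythagorean[of "x - p" "p - y"] by simp
    then have "(dist x p)\<^sup>2 \<le> (dist x y)\<^sup>2"
      by (simp add: dist_norm)
    then show ?thesis by (rule power2_le_imp_le) simp
  qed
  then show "dist x p \<le> infdist x L"
    using p by (subst infdist_notempty) (auto intro: cINF_greatest)
qed

lemma inner_eq_cos_vec_angle: "u \<bullet> v = norm u * norm v * cos (vec_angle u v)"
proof (cases "u = 0 \<or> v = 0")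
  case False
  have "\<bar>u \<bullet> v / (norm u * norm v)\<bar> \<le> 1"
    using Cauchy_Schwarz_ineq2[of u v] False by (simp add: abs_mult divide_simps)
  then show ?thesis
    using False by (simp add: vec_angle_def cos_arccos_abs)
qed auto

section \<open>The altitude of a right simplex\<close>

text \<open>By pairwise orthogonality only the summand with \<open>i = j\<close> survives. As the product does
  not depend on \<open>j\<close>, the sum is a normal vector of the facet opposite to \<open>S\<close>.\<close>

lemma inner_edge_normal_right_simplex:
  fixes A :: "'n \<Rightarrow> real ^ 'n"
  assumes S: "S \<notin> range A" and right: "right_at S A"
  shows "(A j - S) \<bullet> (\<Sum>i\<in>UNIV. (A i - S) /\<^sub>R (dist S (A i))\<^sup>2) = 1"
proof -
  have uu: "(A j - S) \<bullet> (A j - S) = (dist S (A j))\<^sup>2"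
    by (simp add: dist_norm norm_minus_commute[of S] power2_norm_eq_inner)
  have nz: "dist S (A j) \<noteq> 0" using S by auto
  have "(A j - S) \<bullet> (\<Sum>i\<in>UNIV. (A i - S) /\<^sub>R (dist S (A i))\<^sup>2)
      = (\<Sum>i\<in>UNIV. if i = j then 1 else 0)"
    unfolding inner_sum_right
  proof (rule sum.cong[OF refl])
    fix i
    show "(A j - S) \<bullet> ((A i - S) /\<^sub>R (dist S (A i))\<^sup>2) = (if i = j then 1 else 0)"
      using right nz uu by (auto simp: right_at_def orthogonal_def)
  qed
  then show ?thesis by simp
qed

text \<open>The foot vector \<open>q\<close> has the same inner product \<open>q \<bullet> q\<close> with every \<open>u\<^sub>i\<close>. With
  \<open>z = \<Sum>\<^sub>i u\<^sub>i / SA\<^sub>i\<^sup>2\<close> this makes \<open>q \<bullet> z\<close> equal to \<open>h\<^sup>2\<close> times the sum below, whereas the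
  facet lies in the hyperplane of all points whose vector from \<open>S\<close> has inner product \<open>1\<close> with
  \<open>z\<close>, so \<open>q \<bullet> z = 1\<close>.\<close>

lemma altitude_right_simplex:
  fixes A :: "'n \<Rightarrow> real ^ 'n"
  assumes S: "S \<notin> range A" and right: "right_at S A"
    and P: "is_foot (affine hull (range A)) S P"
  shows "(\<Sum>i\<in>UNIV. 1 / (dist S (A i))\<^sup>2) = 1 / (dist S P)\<^sup>2"
proof -
  define z where "z = (\<Sum>i\<in>UNIV. (A i - S) /\<^sub>R (dist S (A i))\<^sup>2)"
  define q where "q = P - S"
  have uz: "(A j - S) \<bullet> z = 1" for j
    unfolding z_def by (rule inner_edge_normal_right_simplex[OF S right])
  have "affine hull (range A) \<subseteq> {x. z \<bullet> x = 1 + z \<bullet> S}"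
  proof (rule hull_minimal)
    show "range A \<subseteq> {x. z \<bullet> x = 1 + z \<bullet> S}"
      using uz by (auto simp: inner_diff_left inner_commute algebra_simps)
  qed (rule affine_hyperplane)
  then have qz: "q \<bullet> z = 1"
    using P by (auto simp: is_foot_def q_def inner_diff_right inner_commute[of "P - S" z])
  have qu: "q \<bullet> (A i - S) = (dist S P)\<^sup>2" for i
  proof -
    have "A i \<in> affine hull (range A)" by (simp add: hull_inc)
    then have "(S - P) \<bullet> (A i - P) = 0"
      using P by (simp add: is_foot_def orthogonal_def)
    then have "q \<bullet> (A i - S) = q \<bullet> q"
      by (simp add: q_def inner_diff inner_commute)
    then show ?thesis
      by (simp add: q_def dist_norm norm_minus_commute power2_norm_eq_inner)
  qed
  have "q \<bullet> z = (dist S P)\<^sup>2 * (\<Sum>i\<in>UNIV. 1 / (dist S (A i))\<^sup>2)"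
    by (simp add: z_def inner_sum_right qu sum_distrib_left divide_inverse mult.commute)
  then have *: "(dist S P)\<^sup>2 * (\<Sum>i\<in>UNIV. 1 / (dist S (A i))\<^sup>2) = 1"
    using qz by simp
  then have "(dist S P)\<^sup>2 \<noteq> 0" by auto
  with * show ?thesis by (simp add: eq_divide_eq mult.commute)
qed

section \<open>The weighted sum of squared distances\<close>

theorem theorem6p3:
  fixes S F P z :: "real ^ 'n"
    and A B H :: "'n \<Rightarrow> real ^ 'n"
    and L' :: "(real ^ 'n) set"
    and k :: nat
    and d h \<phi> lam :: real
  assumes simplex: "simplex_vertices S A"
    and right: "right_at S A"
    and L': "affine L'" "aff_dim L' = int k"
    and k: "1 \<le> k" "k \<le> CARD('n) - 1"
    and d: "d = infdist S L'"
    and F: "is_foot L' S F"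
    and z: "z = (\<Sum>i\<in>UNIV. (A i - S) /\<^sub>R (dist S (A i))\<^sup>2)"
    and P: "is_foot (affine hull (range A)) S P"
    and h: "h = dist S P"
    and \<phi>: "d > 0 \<Longrightarrow> \<phi> = vec_angle (F - S) z"
    and H: "\<And>i. is_foot L' (A i) (H i)"
    and B: "\<And>i. B i - S = lam *\<^sub>R (A i - S)"
  shows "(\<Sum>i\<in>UNIV. (dist (B i) (H i))\<^sup>2 / (dist S (A i))\<^sup>2)
       = real CARD('n) * lam\<^sup>2 - 2 * real k * lam + real k + d\<^sup>2 / h\<^sup>2
         - (if d = 0 then 0 else 2 * lam * (d / h) * cos \<phi>)"
proof -
  define u where "u i = A i - S" for i
  define r where "r i = norm (u i)" for i
  define f where "f = F - S"
  define g where "g i = H i - F" for i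
  define V where "V = (\<lambda>x. x - F) ` L'"
  have S: "S \<notin> range A" using simplex by (simp add: simplex_vertices_def)
  then have rpos: "r i > 0" for i by (auto simp: r_def u_def)
  have r: "dist S (A i) = r i" for i by (simp add: r_def u_def dist_norm norm_minus_commute)
  have orth: "u i \<bullet> u j = 0" if "i \<noteq> j" for i j
    using right that by (simp add: right_at_def orthogonal_def u_def)
  have FL: "F \<in> L'" using F by (simp add: is_foot_def)
  have V: "subspace V" unfolding V_def by (rule affine_diffs_subspace_subtract[OF L'(1) FL])
  have dimV: "dim V = k"
    using aff_dim_eq_dim_subtract[of F L'] FL L'(2) by (simp add: V_def hull_inc)
  have VL: "v + F \<in> L'" if "v \<in> V" for v using that by (auto simp: V_def)
  have gV: "g i \<in> V" for i using H[of i] by (auto simp: g_def V_def is_foot_def)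
  have fV: "f \<bullet> v = 0" if "v \<in> V" for v
  proof -
    have "(S - F) \<bullet> (v + F - F) = 0"
      using F VL[OF that] unfolding is_foot_def orthogonal_def by blast
    then show ?thesis by (simp add: f_def inner_diff_left)
  qed
  have uV: "u i \<bullet> v = g i \<bullet> v" if v: "v \<in> V" for i v
  proof -
    have "v + g i \<in> V" using V v gV by (rule subspace_add)
    then have "(A i - H i) \<bullet> (v + g i + F - H i) = 0"
      using VL H[of i] unfolding is_foot_def orthogonal_def by blast
    moreover have "v + g i + F - H i = v" by (simp add: g_def)
    ultimately have "(A i - H i) \<bullet> v = 0" by simp
    moreover have "A i - H i = u i - g i - f" by (simp add: u_def g_def f_def)
    ultimately show ?thesis using fV[OF v] by (simp add: inner_diff_left)
  qed
  have "(\<Sum>i\<in>UNIV. (norm (g i /\<^sub>R r i))\<^sup>2) = real (dim V)"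
  proof (rule sum_norm_feet_orthonormal[OF _ _ V])
    show "norm (u i /\<^sub>R r i) = 1" for i using rpos[of i] by (simp add: r_def)
    show "orthogonal (u i /\<^sub>R r i) (u j /\<^sub>R r j)" if "i \<noteq> j" for i j
      using orth[OF that] by (simp add: orthogonal_def)
    show "is_foot V (u i /\<^sub>R r i) (g i /\<^sub>R r i)" for i
    proof -
      have 1: "g i /\<^sub>R r i \<in> V" using gV V by (simp add: subspace_scale)
      have "(u i /\<^sub>R r i - g i /\<^sub>R r i) \<bullet> (v - g i /\<^sub>R r i) = 0" if "v \<in> V" for v
        using uV[OF subspace_diff[OF V that 1]] by (simp add: inner_diff_left)
      with 1 show ?thesis by (simp add: is_foot_def orthogonal_def)
    qed
  qed
  then have trace: "(\<Sum>i\<in>UNIV. (norm (g i))\<^sup>2 / (r i)\<^sup>2) = real k"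
    by (simp add: dimV power_mult_distrib power_inverse divide_inverse mult.commute)
  have alt: "(\<Sum>i\<in>UNIV. 1 / (r i)\<^sup>2) = 1 / h\<^sup>2"
    using altitude_right_simplex[OF S right P] by (simp add: r h)
  have zz: "(norm z)\<^sup>2 = 1 / h\<^sup>2"
  proof -
    have "u i \<bullet> z = 1" for i
      unfolding u_def z by (rule inner_edge_normal_right_simplex[OF S right])
    moreover have "z \<bullet> z = (\<Sum>i\<in>UNIV. (u i \<bullet> z) / (r i)\<^sup>2)"
      by (subst (1) z) (simp add: r u_def inner_sum_left divide_inverse mult.commute)
    ultimately have "z \<bullet> z = (\<Sum>i\<in>UNIV. 1 / (r i)\<^sup>2)" by simp
    then show ?thesis using alt by (simp add: power2_norm_eq_inner)
  qed
  have nz: "norm z = 1 / h"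
  proof (rule power2_eq_imp_eq)
    show "(norm z)\<^sup>2 = (1 / h)\<^sup>2" using zz by (simp add: power_divide)
  qed (simp_all add: h)
  have df: "d = norm f"
    using infdist_foot[OF F] by (simp add: d f_def dist_norm norm_minus_commute)
  have fz: "f \<bullet> z = (if d = 0 then 0 else d / h * cos \<phi>)"
  proof (cases "d = 0")
    case False
    then have "d > 0" by (simp add: df)
    then show ?thesis
      using inner_eq_cos_vec_angle[of f z] \<phi> by (simp add: nz df f_def)
  qed (use df in simp)
  have fz_sum: "f \<bullet> z = (\<Sum>i\<in>UNIV. u i \<bullet> f / (r i)\<^sup>2)"
    by (simp add: z r u_def[symmetric] inner_sum_right inner_commute divide_inverse mult.commute)
  have "(dist (B i) (H i))\<^sup>2 / (r i)\<^sup>2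
      = lam\<^sup>2 + (1 - 2 * lam) * ((norm (g i))\<^sup>2 / (r i)\<^sup>2) + d\<^sup>2 * (1 / (r i)\<^sup>2)
        - 2 * lam * (u i \<bullet> f / (r i)\<^sup>2)" for i
  proof -
    have "B i - H i = lam *\<^sub>R u i - g i - f"
      using B[of i] by (simp add: u_def g_def f_def algebra_simps)
    then have "(dist (B i) (H i))\<^sup>2 = (lam *\<^sub>R u i - g i - f) \<bullet> (lam *\<^sub>R u i - g i - f)"
      by (simp add: dist_norm power2_norm_eq_inner)
    also have "\<dots> = lam\<^sup>2 * (u i \<bullet> u i) + (1 - 2 * lam) * (g i \<bullet> g i) + f \<bullet> f - 2 * lam * (u i \<bullet> f)"
      using uV[OF gV, of i i] fV[OF gV, of i]
      by (simp add: inner_diff_left inner_diff_right inner_commute power2_eq_square algebra_simps)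
    also have "\<dots> = lam\<^sup>2 * (r i)\<^sup>2 + (1 - 2 * lam) * (norm (g i))\<^sup>2 + d\<^sup>2 - 2 * lam * (u i \<bullet> f)"
      by (simp add: r_def df power2_norm_eq_inner)
    finally show ?thesis
      using rpos[of i] by (simp add: add_divide_distrib diff_divide_distrib)
  qed
  then have "(\<Sum>i\<in>UNIV. (dist (B i) (H i))\<^sup>2 / (dist S (A i))\<^sup>2)
      = real CARD('n) * lam\<^sup>2 + (1 - 2 * lam) * (\<Sum>i\<in>UNIV. (norm (g i))\<^sup>2 / (r i)\<^sup>2)
        + d\<^sup>2 * (\<Sum>i\<in>UNIV. 1 / (r i)\<^sup>2) - 2 * lam * (\<Sum>i\<in>UNIV. u i \<bullet> f / (r i)\<^sup>2)"
    unfolding r by (simp only: sum.distrib sum_subtractf sum_distrib_left[symmetric] sum_constant)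
  also have "\<dots> = real CARD('n) * lam\<^sup>2 + (1 - 2 * lam) * real k + d\<^sup>2 / h\<^sup>2 - 2 * lam * (f \<bullet> z)"
    by (simp add: trace alt fz_sum)
  finally show ?thesis by (cases "d = 0") (simp_all add: fz algebra_simps)
qed

end
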